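(* Let $h \in \mathbb{H}(\mathbb{Q})$, with $CF(h)=\{\gamma_i\}_{i=0}^n$. Suppose one can write $h$ as a fraction with denominator $q\in\mathbb{Z}[i]$. Then $|q|\ge 2^{n/2}$.
   Context: The Heisenberg group $\mathbb H=\mathbb C\times\mathbb R$ with law $(z,t)*(z',t')=(z+z',t+t'+2\operatorname{Im}(\overline z z'))$, gauge norm $\|(z,t)\|=\sqrt[4]{|z|^4+t^2}$; $\mathbb H(\mathbb Z)=\mathbb Z[i]\times\mathbb Z$ and $\mathbb H(\mathbb Q)$ the points with rational coordinates. $CF(h)$ is the sequence of continued fraction digits of $h$ with respect to a fundamental domain $K$ for $\mathbb H(\mathbb Z)$ of radius $\operatorname{rad}(K)=\sup_{k\in K}\|k\|\le\sqrt[4]{1/2}$, such as the unit cube $K_C=[-1/2,1/2)^3$ or the Dirichlet domain $K_D$: with $[h]=g$ iff $h\in g*K$ and $\iota(z,t)=\left(\frac{-z}{|z|^2+it},\frac{-t}{|z|^4+t^2}\right)$ the Koranyi inversion, $\gamma_0=[h]$, $h_0=\gamma_0^{-1}*h$, $\gamma_{i+1}=[\iota h_i]$, $h_{i+1}=\gamma_{i+1}^{-1}*\iota h_i$. "Writing $h$ as a fraction with denominator $q$" refers to the planar Siegel coordinates $h=(r/q,p/q)$ with $q,r,p\in\mathbb Z[i]$, where a point $(z,t)$ has planar Siegel coordinates $(u,v)=(z(1+i),|z|^2+it)$. *)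

theory Defs
  imports Complex_Main "HOL-Library.Extended_Real" "HOL-Algebra.Coset"
begin

type_synonym heis = "complex \<times> real"

definition heisenberg :: "heis monoid" where
  "heisenberg = \<lparr>carrier = UNIV,
     mult = (\<lambda>(z, t) (z', t'). (z + z', t + t' + 2 * Im (cnj z * z'))),
     one = (0, 0)\<rparr>"

lemma carrier_heisenberg [simp]: "carrier heisenberg = UNIV"
  by (simp add: heisenberg_def)

lemma mult_heisenberg [simp]:
  "(z, t) \<otimes>\<^bsub>heisenberg\<^esub> (z', t') = (z + z', t + t' + 2 * Im (cnj z * z'))"
  by (simp add: heisenberg_def)

lemma one_heisenberg [simp]: "\<one>\<^bsub>heisenberg\<^esub> = (0, 0)"
  by (simp add: heisenberg_def)

lemma group_heisenberg: "group heisenberg"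
proof (rule groupI)
  fix x :: heis
  show "\<exists>y\<in>carrier heisenberg. y \<otimes>\<^bsub>heisenberg\<^esub> x = \<one>\<^bsub>heisenberg\<^esub>"
    by (cases x; rule bexI[where x = "(- fst x, - snd x)"]) auto
qed (auto simp: algebra_simps)

lemma inv_heisenberg [simp]: "inv\<^bsub>heisenberg\<^esub> (z, t) = (- z, - t)"
  by (rule group.inv_equality[OF group_heisenberg]) simp_all

definition gauge_norm :: "heis \<Rightarrow> real" where
  "gauge_norm = (\<lambda>(z, t). root 4 (cmod z ^ 4 + t ^ 2))"

definition gaussian_integers :: "complex set" where
  "gaussian_integers = {z. Re z \<in> \<int> \<and> Im z \<in> \<int>}"

definition heis_int :: "heis set" where
  "heis_int = gaussian_integers \<times> \<int>"

definition heis_rat :: "heis set" where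
  "heis_rat = {z. Re z \<in> \<rat> \<and> Im z \<in> \<rat>} \<times> \<rat>"

lemma subgroup_heis_int: "subgroup heis_int heisenberg"
  by (rule group.subgroupI[OF group_heisenberg])
     (auto simp: heis_int_def gaussian_integers_def intro!: exI[where x = 0])

text \<open>A fundamental domain is strict, in that the translates partition the group, so that the
  integer part below is defined at every point.\<close>

definition fundamental_domain :: "heis set \<Rightarrow> bool" where
  "fundamental_domain K \<longleftrightarrow> (\<forall>h. \<exists>!g. g \<in> heis_int \<and> h \<in> g <#\<^bsub>heisenberg\<^esub> K)"

text \<open>The supremum is taken in the extended reals, so that a finite upper bound on the radius
  includes boundedness.\<close>

definition rad :: "heis set \<Rightarrow> ereal" where
  "rad K = (SUP k\<in>K. ereal (gauge_norm k))"

definition int_part :: "heis set \<Rightarrow> heis \<Rightarrow> heis" where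
  "int_part K h = (THE g. g \<in> heis_int \<and> h \<in> g <#\<^bsub>heisenberg\<^esub> K)"

definition koranyi_inversion :: "heis \<Rightarrow> heis" where
  "koranyi_inversion = (\<lambda>(z, t).
     (- z / (of_real (cmod z ^ 2) + \<i> * of_real t), - t / (cmod z ^ 4 + t ^ 2)))"

text \<open>The sequences $\gamma_i$ and $h_i$ are total here. Since division by zero gives zero, the
  inversion sends the origin to itself, and the values after the first vanishing $h_i$ carry no
  meaning: the expansion stops at that index.\<close>

fun cf_digit :: "heis set \<Rightarrow> heis \<Rightarrow> nat \<Rightarrow> heis"
  and cf_remainder :: "heis set \<Rightarrow> heis \<Rightarrow> nat \<Rightarrow> heis" where
  "cf_digit K h 0 = int_part K h"
| "cf_digit K h (Suc i) = int_part K (koranyi_inversion (cf_remainder K h i))"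
| "cf_remainder K h 0 = inv\<^bsub>heisenberg\<^esub> (cf_digit K h 0) \<otimes>\<^bsub>heisenberg\<^esub> h"
| "cf_remainder K h (Suc i) =
     inv\<^bsub>heisenberg\<^esub> (cf_digit K h (Suc i))
       \<otimes>\<^bsub>heisenberg\<^esub> koranyi_inversion (cf_remainder K h i)"

definition CF :: "heis set \<Rightarrow> heis \<Rightarrow> nat \<Rightarrow> heis option" where
  "CF K h i =
     (if \<forall>j<i. cf_remainder K h j \<noteq> (0, 0) then Some (cf_digit K h i) else None)"

definition siegel :: "heis \<Rightarrow> complex \<times> complex" where
  "siegel = (\<lambda>(z, t). (z * (1 + \<i>), of_real (cmod z ^ 2) + \<i> * of_real t))"

definition fraction_with_denominator :: "heis \<Rightarrow> complex \<Rightarrow> bool" where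
  "fraction_with_denominator h q \<longleftrightarrow> q \<in> gaussian_integers \<and> q \<noteq> 0 \<and>
     (\<exists>r\<in>gaussian_integers. \<exists>p\<in>gaussian_integers. siegel h = (r / q, p / q))"

end

theory Submission
  imports Defs
begin

text \<open>In planar Siegel coordinates the Koranyi inversion is \<open>(u, v) \<mapsto> (- u / v, 1 / v)\<close>, so it turns
  the fraction \<open>(r / q, p / q)\<close> into \<open>(- r / p, q / p)\<close>, while integral translations keep the
  denominator. Since \<open>\<bar>p / q\<bar>\<close> is the square of the gauge norm, every step of the expansion divides
  the modulus of the denominator by at least \<open>sqrt 2\<close>; a nonzero Gaussian integer has modulus
  at least \<open>1\<close>, which bounds the number of steps.\<close>

lemma gaussian_integers_closed:
  assumes "x \<in> gaussian_integers" "y \<in> gaussian_integers"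
  shows "x + y \<in> gaussian_integers" "x * y \<in> gaussian_integers"
    "- x \<in> gaussian_integers" "cnj x \<in> gaussian_integers"
  using assms by (auto simp: gaussian_integers_def)

lemma norm_gaussian_integer_ge_1:
  assumes "x \<in> gaussian_integers" "x \<noteq> 0"
  shows "cmod x \<ge> 1"
proof -
  have *: "\<bar>a\<bar> \<ge> 1" if "a \<in> \<int>" "a \<noteq> 0" for a :: real
    using that by (rule Ints_nonzero_abs_ge1)
  have "Re x \<noteq> 0 \<or> Im x \<noteq> 0"
    using assms(2) by (auto simp: complex_eq_iff)
  with * assms(1) have "\<bar>Re x\<bar> \<ge> 1 \<or> \<bar>Im x\<bar> \<ge> 1"
    by (auto simp: gaussian_integers_def)
  then show ?thesis
    using abs_Re_le_cmod[of x] abs_Im_le_cmod[of x] by linarith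
qed

text \<open>Expanding \<open>cmod (w + z) ^ 2\<close> and adding the cocycle term leaves the cross
  term \<open>2 * cnj w * z\<close>, and 2 = (1 + \<i>)(1 - \<i>). So for integral
  \<open>(w, s)\<close> the translation is affine with Gaussian integer coefficients.\<close>

lemma siegel_mult:
  "siegel ((w, s) \<otimes>\<^bsub>heisenberg\<^esub> h) =
     (w * (1 + \<i>) + fst (siegel h),
      of_real (cmod w ^ 2) + \<i> * of_real s + cnj w * (1 - \<i>) * fst (siegel h) + snd (siegel h))"
  by (cases h) (simp add: siegel_def complex_eq_iff cmod_power2,
      simp add: power2_eq_square algebra_simps)

text \<open>With \<open>v\<close> the second coordinate, \<open>cmod v ^ 2\<close> is the
  denominator \<open>cmod z ^ 4 + t ^ 2\<close> of the inversion, so the new second coordinate is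
  \<open>cnj v / cmod v ^ 2\<close>. At the origin both sides vanish because division by zero gives
  zero.\<close>

lemma siegel_koranyi_inversion:
  "siegel (koranyi_inversion h) = (- fst (siegel h) / snd (siegel h), 1 / snd (siegel h))"
proof -
  obtain z t where h: "h = (z, t)"
    by (cases h)
  define v where "v = of_real (cmod z ^ 2) + \<i> * of_real t"
  have norm_v: "cmod v ^ 2 = cmod z ^ 4 + t ^ 2"
    unfolding cmod_power2 by (simp add: v_def)
  have "of_real (cmod (z / v) ^ 2) + \<i> * of_real (- t / (cmod z ^ 4 + t ^ 2))
      = cnj v / of_real (cmod v ^ 2)"
    by (simp add: norm_divide power_divide norm_v[symmetric] v_def diff_divide_distrib)
  also have "\<dots> = 1 / v"
    using complex_div_cnj[of 1 v] by simp
  finally show ?thesis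
    by (simp add: h siegel_def koranyi_inversion_def v_def)
qed

lemma norm_snd_siegel: "cmod (snd (siegel h)) = gauge_norm h ^ 2"
proof -
  obtain z t where h: "h = (z, t)"
    by (cases h)
  have "(gauge_norm h ^ 2) ^ 2 = cmod z ^ 4 + t ^ 2"
    by (simp add: h gauge_norm_def real_root_pow_pos2 flip: power_mult)
  moreover have "cmod (snd (siegel h)) ^ 2 = cmod z ^ 4 + t ^ 2"
    unfolding cmod_power2 by (simp add: siegel_def h)
  ultimately show ?thesis
    by (metis norm_ge_zero power2_eq_iff_nonneg zero_le_power2)
qed

lemma snd_siegel_eq_0_iff: "snd (siegel h) = 0 \<longleftrightarrow> h = (0, 0)"
  by (cases h) (auto simp: siegel_def complex_eq_iff)

text \<open>The numerators are determined by \<open>q\<close>, so the existential quantifiers can be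
  traded for integrality of two products.\<close>

lemma fraction_with_denominator_iff:
  "fraction_with_denominator h q \<longleftrightarrow> q \<in> gaussian_integers \<and> q \<noteq> 0 \<and>
     fst (siegel h) * q \<in> gaussian_integers \<and> snd (siegel h) * q \<in> gaussian_integers"
  by (cases "q = 0")
     (auto simp: fraction_with_denominator_def prod_eq_iff field_simps)

lemma fraction_with_denominator_mult:
  assumes "g \<in> heis_int" "fraction_with_denominator h q"
  shows "fraction_with_denominator (g \<otimes>\<^bsub>heisenberg\<^esub> h) q"
proof -
  obtain w s where g: "g = (w, s)" and w: "w \<in> gaussian_integers" and s: "s \<in> \<int>"
    using assms(1) by (auto simp: heis_int_def)
  define v where "v = of_real (cmod w ^ 2) + \<i> * of_real s"
  have v: "v \<in> gaussian_integers"
    using w s unfolding v_def cmod_power2 by (auto simp: gaussian_integers_def)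
  have i: "1 + \<i> \<in> gaussian_integers" "1 - \<i> \<in> gaussian_integers"
    by (auto simp: gaussian_integers_def)
  have q: "q \<in> gaussian_integers" "q \<noteq> 0" "fst (siegel h) * q \<in> gaussian_integers"
      "snd (siegel h) * q \<in> gaussian_integers"
    using assms(2) by (simp_all add: fraction_with_denominator_iff)
  have "fst (siegel (g \<otimes>\<^bsub>heisenberg\<^esub> h)) * q \<in> gaussian_integers"
    unfolding g siegel_mult fst_conv distrib_right
    by (intro gaussian_integers_closed w i q)
  \<comment> \<open>Only the products of the Siegel coordinates with \<open>q\<close> are known to
    be integral, so each coordinate is grouped with \<open>q\<close>.\<close>
  moreover have "v * q + cnj w * (1 - \<i>) * (fst (siegel h) * q) + snd (siegel h) * q
      \<in> gaussian_integers"
    by (rule w v i q gaussian_integers_closed)+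
  then have "snd (siegel (g \<otimes>\<^bsub>heisenberg\<^esub> h)) * q \<in> gaussian_integers"
    unfolding g siegel_mult v_def by (simp add: algebra_simps)
  ultimately show ?thesis
    using q by (simp add: fraction_with_denominator_iff)
qed

text \<open>The new denominator is the old numerator \<open>p\<close> of the second coordinate; it
  is nonzero because \<open>h\<close> is not the origin.\<close>

lemma fraction_with_denominator_koranyi_inversion:
  assumes "fraction_with_denominator h q" "h \<noteq> (0, 0)"
  shows "fraction_with_denominator (koranyi_inversion h) (snd (siegel h) * q)"
  using assms snd_siegel_eq_0_iff[of h] gaussian_integers_closed(3)[of "fst (siegel h) * q"]
  by (auto simp: fraction_with_denominator_iff siegel_koranyi_inversion)

lemma int_part:
  assumes "fundamental_domain K"
  shows "int_part K h \<in> heis_int"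
    and "inv\<^bsub>heisenberg\<^esub> (int_part K h) \<otimes>\<^bsub>heisenberg\<^esub> h \<in> K"
proof -
  interpret group heisenberg
    by (rule group_heisenberg)
  have *: "int_part K h \<in> heis_int \<and> h \<in> int_part K h <#\<^bsub>heisenberg\<^esub> K"
    unfolding int_part_def by (rule theI') (use assms in \<open>unfold fundamental_domain_def, blast\<close>)
  then show "int_part K h \<in> heis_int" ..
  from * obtain k where "k \<in> K" "h = int_part K h \<otimes>\<^bsub>heisenberg\<^esub> k"
    by (auto simp: l_coset_def)
  then show "inv\<^bsub>heisenberg\<^esub> (int_part K h) \<otimes>\<^bsub>heisenberg\<^esub> h \<in> K"
    by (metis UNIV_I carrier_heisenberg inv_solve_left)
qed

text \<open>Every remainder arises by removing an integer part, even past the end of the expansion,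
  so no nonvanishing condition is required.\<close>

lemma cf_remainder_in_domain:
  assumes "fundamental_domain K"
  shows "cf_remainder K h i \<in> K"
  by (cases i) (simp_all add: int_part(2)[OF assms])

text \<open>Only remainders before index \<open>i\<close> must be nonzero, since reaching the
  remainder at \<open>i\<close> takes exactly \<open>i\<close> inversions; that remainder itself may
  vanish.\<close>

lemma cf_remainder_fraction:
  assumes K: "fundamental_domain K" "rad K \<le> ereal (root 4 (1 / 2))"
    and q: "fraction_with_denominator h q"
    and nz: "\<And>j. j < i \<Longrightarrow> cf_remainder K h j \<noteq> (0, 0)"
  shows "\<exists>q'. fraction_with_denominator (cf_remainder K h i) q' \<and> sqrt 2 ^ i * cmod q' \<le> cmod q"
  using nz
proof (induction i)
  case 0
  have "inv\<^bsub>heisenberg\<^esub> (int_part K h) \<in> heis_int"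
    by (intro subgroup.m_inv_closed[OF subgroup_heis_int] int_part(1) K)
  then show ?case
    using q by (auto intro!: exI[of _ q] fraction_with_denominator_mult)
next
  case (Suc i)
  define k where "k = cf_remainder K h i"
  obtain q' where q': "fraction_with_denominator k q'" "sqrt 2 ^ i * cmod q' \<le> cmod q"
    using Suc by (auto simp: k_def)
  have "ereal (gauge_norm k) \<le> rad K"
    unfolding rad_def k_def by (intro SUP_upper cf_remainder_in_domain K)
  then have "gauge_norm k \<le> root 4 (1 / 2)"
    using K(2) by (metis ereal_less_eq(3) order_trans)
  \<comment> \<open>The fourth power removes the root: the radius bound says precisely that the
    second Siegel coordinate has modulus at most \<open>sqrt (1 / 2)\<close>, which is the
    contraction factor of one step.\<close>
  then have "gauge_norm k ^ 4 \<le> root 4 (1 / 2) ^ 4"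
    by (intro power_mono) (auto simp: gauge_norm_def split: prod.split)
  then have "(gauge_norm k ^ 2) ^ 2 \<le> 1 / 2"
    by (simp flip: power_mult)
  then have "gauge_norm k ^ 2 \<le> sqrt (1 / 2)"
    by (rule real_le_rsqrt)
  then have norm_k: "sqrt 2 * cmod (snd (siegel k)) \<le> 1"
    unfolding norm_snd_siegel by (simp add: real_sqrt_divide field_simps)
  have "sqrt 2 ^ Suc i * cmod (snd (siegel k) * q')
      = (sqrt 2 * cmod (snd (siegel k))) * (sqrt 2 ^ i * cmod q')"
    by (simp add: norm_mult)
  also have "\<dots> \<le> 1 * (sqrt 2 ^ i * cmod q')"
    by (intro mult_right_mono norm_k) auto
  also have "\<dots> \<le> cmod q"
    using q'(2) by simp
  finally have "sqrt 2 ^ Suc i * cmod (snd (siegel k) * q') \<le> cmod q" .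
  moreover have "inv\<^bsub>heisenberg\<^esub> (int_part K (koranyi_inversion k)) \<in> heis_int"
    by (intro subgroup.m_inv_closed[OF subgroup_heis_int] int_part(1) K)
  then have "fraction_with_denominator (cf_remainder K h (Suc i)) (snd (siegel k) * q')"
    using q'(1) Suc.prems[of i]
    by (auto simp: k_def intro!: fraction_with_denominator_mult
        fraction_with_denominator_koranyi_inversion)
  ultimately show ?case
    by blast
qed

theorem theorem3p11:
  fixes K :: "heis set" and h :: heis and q :: complex
    and \<gamma> :: "nat \<Rightarrow> heis" and n :: nat
  assumes "fundamental_domain K"
    and "rad K \<le> ereal (root 4 (1 / 2))"
    and "h \<in> heis_rat"
    and "CF K h = (\<lambda>i. if i \<le> n then Some (\<gamma> i) else None)"
    and "fraction_with_denominator h q"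
  shows "cmod q \<ge> 2 powr (real n / 2)"
proof -
  \<comment> \<open>That digit \<open>n\<close> is defined encodes that the expansion has not
    stopped earlier.\<close>
  have "CF K h n \<noteq> None"
    using assms(4) by simp
  then have "\<And>j. j < n \<Longrightarrow> cf_remainder K h j \<noteq> (0, 0)"
    by (auto simp: CF_def split: if_splits)
  then obtain q' where q': "fraction_with_denominator (cf_remainder K h n) q'"
      "sqrt 2 ^ n * cmod q' \<le> cmod q"
    using cf_remainder_fraction[OF assms(1,2,5)] by blast
  have "2 powr (real n / 2) = sqrt 2 ^ n"
    by (simp add: powr_half_sqrt[symmetric] powr_powr flip: powr_realpow)
  also have "\<dots> \<le> sqrt 2 ^ n * cmod q'"
    using q'(1) norm_gaussian_integer_ge_1[of q'] by (simp add: fraction_with_denominator_def)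
  finally show ?thesis
    using q'(2) by simp
qed

end
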